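(* Let $\mathcal M=(Q,H,\phi)$ be a forced Hamiltonian system, let $h>0$, and let $\mathcal M^E_{d,h}=(Q,H^E_{d,h},\phi^E_{d,h})$ be the exact forced discrete Hamiltonian system associated to $\mathcal M$. (1) If $(q(t),p(t))$ is a trajectory of $\mathcal M$ defined, at least, for $t\in[0,2h]$, then $((q(0),p(0)),(q(h),p(h)),(q(2h),p(2h)))$ is an extended trajectory of $\mathcal M^E_{d,h}$. (2) Conversely, if $((q_0,p_0),(q_1,p_1),(q_2,p_2))$ is an extended trajectory of $\mathcal M^E_{d,h}$, then there is a trajectory $(q(t),p(t))$ of $\mathcal M$ such that $(q_k,p_k)=(q(kh),p(kh))$ for $k=0,1,2$.
   Context: $Q$ is a finite-dimensional real vector space and $T^*Q\simeq Q\times Q^*$. A forced Hamiltonian system is a triple $(Q,H,\phi)$ with $H:T^*Q\to\mathbb R$ smooth and $\phi\in\Omega^1(T^*Q)$ a smooth horizontal 1-form, so that $\phi(q,p)(\delta q,\delta p)=\check\phi(q,p)(\delta q)$ with $\check\phi(q,p)\in Q^*$. Its trajectories are the solutions of the forced Hamilton equations $\dot q=D_2H(q,p)$, $\dot p=-D_1H(q,p)+\check\phi(q,p)$. Standing assumption: for the given $h$ and every $(q_0,p_1)\in Q\times Q^*$ there is a unique trajectory $(q(t),p(t))$ of $\mathcal M$ on $[0,h]$ with $q(0)=q_0$ and $p(h)=p_1$, depending smoothly on $(t,q_0,p_1)$; it is denoted $\mathbf F^{\mathcal M}_{h,t}(q_0,p_1)$ (boundary value flow). The exact forced discrete Hamiltonian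 system associated to $\mathcal M$ is given, with $(q(t),p(t))=\mathbf F^{\mathcal M}_{h,t}(q_0,p_1)$, by $$H^E_{d,h}(q_0,p_1)=p(h)q(h)-\int_0^h\big(p(t)\dot q(t)-H(q(t),p(t))\big)dt,$$ $$\phi^E_{d,h}(q_0,p_1)(\delta q_0,\delta p_1)=\int_0^h\phi(q(t),p(t))\big(T_{(q_0,p_1)}\mathbf F^{\mathcal M}_{h,t}(\delta q_0,\delta p_1)\big)dt.$$ A forced discrete Hamiltonian system (FDHS) is a triple $(Q,H_d,\phi_d)$ with $H_d:T^*Q\to\mathbb R$ smooth and $\phi_d$ a 1-form on $T^*Q$, decomposed as $\phi_d(q,p)(\delta q,\delta p)=\phi_d^q(q,p)(\delta q)+\phi_d^p(q,p)(\delta p)$. A discrete curve $((q_0,p_0),\dots,(q_N,p_N))$ in $T^*Q$ is an extended trajectory of it if and only if $$q_{k+1}=D_2H_d(q_k,p_{k+1})-\phi_d^p(q_k,p_{k+1}),\qquad p_k=D_1H_d(q_k,p_{k+1})-\phi_d^q(q_k,p_{k+1}),\qquad k=0,\dots,N-1.$$ *)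

theory Defs
  imports "HOL-Analysis.Analysis"
begin

text \<open>
  The configuration space \<open>Q\<close> is a type \<open>'a :: euclidean_space\<close>; its inner product is not used in any
  definition. The dual \<open>Q\<^sup>*\<close> is the space of (automatically continuous) linear functionals on \<open>'a\<close>.
\<close>

type_synonym 'a dual = "'a \<Rightarrow>\<^sub>L real"
type_synonym 'a cotangent = "'a \<times> 'a dual"
type_synonym 'a one_form = "'a cotangent \<Rightarrow> 'a cotangent \<Rightarrow>\<^sub>L real"

section \<open>Smooth maps\<close>

text \<open>
  Intended for finite-dimensional domains (where asking for continuity of all iterated directional
  derivatives is the usual \<open>C\<^sup>k\<close> condition) and for sets \<open>S\<close> on which derivatives within \<open>S\<close> are
  unique: the whole space, or \<open>{0..h} \<times> UNIV\<close> with \<open>h > 0\<close>, where the condition is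
  smoothness up to the boundary.
\<close>

primrec C_k_on :: "nat \<Rightarrow> 'a::real_normed_vector set \<Rightarrow> ('a \<Rightarrow> 'b::real_normed_vector) \<Rightarrow> bool" where
  "C_k_on 0 S f \<longleftrightarrow> continuous_on S f"
| "C_k_on (Suc k) S f \<longleftrightarrow>
     (\<exists>f'. (\<forall>x\<in>S. (f has_derivative f' x) (at x within S)) \<and> (\<forall>v. C_k_on k S (\<lambda>x. f' x v)))"

definition smooth_on :: "'a::real_normed_vector set \<Rightarrow> ('a \<Rightarrow> 'b::real_normed_vector) \<Rightarrow> bool" where
  "smooth_on S f \<longleftrightarrow> (\<forall>k. C_k_on k S f)"

section \<open>The canonical identification of a space with its bidual\<close>

definition to_bidual :: "'a::euclidean_space \<Rightarrow> ('a dual) dual" where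
  "to_bidual q = Blinfun (\<lambda>\<alpha>. blinfun_apply \<alpha> q)"

definition of_bidual :: "('a::euclidean_space dual) dual \<Rightarrow> 'a" where
  "of_bidual = inv to_bidual"

lemma to_bidual_apply [simp]: "blinfun_apply (to_bidual q) \<alpha> = blinfun_apply \<alpha> q"
  unfolding to_bidual_def by (simp add: bounded_linear_Blinfun_apply blinfun.bounded_linear_left)

lemma bij_to_bidual: "bij (to_bidual :: 'a::euclidean_space \<Rightarrow> _)"
proof (rule bijI)
  show "inj (to_bidual :: 'a \<Rightarrow> _)"
  proof (rule injI)
    fix x y :: 'a
    assume eq: "to_bidual x = to_bidual y"
    have "x \<bullet> b = y \<bullet> b" for b
    proof -
      have "blinfun_apply (to_bidual x) (blinfun_inner_left b)
          = blinfun_apply (to_bidual y) (blinfun_inner_left b)"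
        using eq by simp
      then show ?thesis by (simp add: inner_commute)
    qed
    then show "x = y" by (blast intro: euclidean_eqI[of x y])
  qed
  show "surj (to_bidual :: 'a \<Rightarrow> _)"
  proof (rule surjI)
    fix \<xi> :: "('a dual) dual"
    let ?f = "\<lambda>\<xi> :: ('a dual) dual. (\<Sum>b\<in>Basis. blinfun_apply \<xi> (blinfun_inner_left b) *\<^sub>R b)"
    show "to_bidual (?f \<xi>) = \<xi>"
    proof (rule blinfun_eqI)
      fix \<alpha> :: "'a dual"
      have "\<alpha> = (\<Sum>b\<in>Basis. blinfun_apply \<alpha> b *\<^sub>R blinfun_inner_left b)"
      proof (rule blinfun_eqI)
        fix v :: 'a
        have "blinfun_apply \<alpha> v = blinfun_apply \<alpha> (\<Sum>b\<in>Basis. (v \<bullet> b) *\<^sub>R b)"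
          by (simp add: euclidean_representation)
        also have "\<dots> = (\<Sum>b\<in>Basis. (v \<bullet> b) * blinfun_apply \<alpha> b)"
          by (simp only: blinfun.sum_right blinfun.scaleR_right real_scaleR_def)
        finally show "blinfun_apply \<alpha> v
            = blinfun_apply (\<Sum>b\<in>Basis. blinfun_apply \<alpha> b *\<^sub>R blinfun_inner_left b) v"
          by (simp add: blinfun.sum_left blinfun.scaleR_left inner_commute mult.commute)
      qed
      then have "blinfun_apply \<xi> \<alpha>
          = blinfun_apply \<xi> (\<Sum>b\<in>Basis. blinfun_apply \<alpha> b *\<^sub>R blinfun_inner_left b)"
        by (rule arg_cong)
      also have "\<dots> = (\<Sum>b\<in>Basis. blinfun_apply \<alpha> b * blinfun_apply \<xi> (blinfun_inner_left b))"
        by (simp only: blinfun.sum_right blinfun.scaleR_right real_scaleR_def)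
      finally show "blinfun_apply (to_bidual (?f \<xi>)) \<alpha> = blinfun_apply \<xi> \<alpha>"
        by (simp add: blinfun.sum_right blinfun.scaleR_right mult.commute)
    qed
  qed
qed

lemma to_bidual_of_bidual [simp]: "to_bidual (of_bidual \<xi>) = \<xi>"
  unfolding of_bidual_def by (rule surj_f_inv_f[OF bij_is_surj[OF bij_to_bidual]])

lemma of_bidual_to_bidual [simp]: "of_bidual (to_bidual q) = q"
  unfolding of_bidual_def by (rule inv_f_f[OF bij_is_inj[OF bij_to_bidual]])

section \<open>Partial derivatives and components of one-forms\<close>

definition D1 :: "('a::euclidean_space cotangent \<Rightarrow> real) \<Rightarrow> 'a cotangent \<Rightarrow> 'a dual" where
  "D1 f z = Blinfun (frechet_derivative (\<lambda>q. f (q, snd z)) (at (fst z)))"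

definition D2 :: "('a::euclidean_space cotangent \<Rightarrow> real) \<Rightarrow> 'a cotangent \<Rightarrow> ('a dual) dual" where
  "D2 f z = Blinfun (frechet_derivative (\<lambda>p. f (fst z, p)) (at (snd z)))"

definition form_q :: "'a::euclidean_space one_form \<Rightarrow> 'a cotangent \<Rightarrow> 'a dual" where
  "form_q \<phi> z = Blinfun (\<lambda>\<delta>q. blinfun_apply (\<phi> z) (\<delta>q, 0))"

definition form_p :: "'a::euclidean_space one_form \<Rightarrow> 'a cotangent \<Rightarrow> ('a dual) dual" where
  "form_p \<phi> z = Blinfun (\<lambda>\<delta>p. blinfun_apply (\<phi> z) (0, \<delta>p))"

lemma form_q_apply [simp]: "blinfun_apply (form_q \<phi> z) \<delta>q = blinfun_apply (\<phi> z) (\<delta>q, 0)"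
  unfolding form_q_def
  by (simp add: bounded_linear_Blinfun_apply bounded_linear_compose[OF blinfun.bounded_linear_right] bounded_linear_Pair[OF bounded_linear_ident bounded_linear_zero])

lemma form_p_apply [simp]: "blinfun_apply (form_p \<phi> z) \<delta>p = blinfun_apply (\<phi> z) (0, \<delta>p)"
  unfolding form_p_def
  by (simp add: bounded_linear_Blinfun_apply bounded_linear_compose[OF blinfun.bounded_linear_right] bounded_linear_Pair[OF bounded_linear_zero bounded_linear_ident])

section \<open>Forced Hamiltonian systems\<close>

definition horizontal :: "'a::euclidean_space one_form \<Rightarrow> bool" where
  "horizontal \<phi> \<longleftrightarrow> (\<forall>z \<delta>q \<delta>p. blinfun_apply (\<phi> z) (\<delta>q, \<delta>p) = blinfun_apply (form_q \<phi> z) \<delta>q)"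

definition forced_hamiltonian_system ::
    "('a::euclidean_space cotangent \<Rightarrow> real) \<Rightarrow> 'a one_form \<Rightarrow> bool" where
  "forced_hamiltonian_system H \<phi> \<longleftrightarrow> smooth_on UNIV H \<and> smooth_on UNIV \<phi> \<and> horizontal \<phi>"

text \<open>For horizontal \<open>\<phi>\<close>, the force (the \<open>Q\<^sup>*\<close>-valued map representing \<open>\<phi>\<close>) is \<open>form_q \<phi>\<close>.\<close>

definition hamilton_field ::
    "('a::euclidean_space cotangent \<Rightarrow> real) \<Rightarrow> 'a one_form \<Rightarrow> 'a cotangent \<Rightarrow> 'a cotangent" where
  "hamilton_field H \<phi> z = (of_bidual (D2 H z), - D1 H z + form_q \<phi> z)"

text \<open>At an endpoint belonging to the interval \<open>I\<close>, the derivative is one-sided.\<close>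

definition trajectory ::
    "('a::euclidean_space cotangent \<Rightarrow> real) \<Rightarrow> 'a one_form \<Rightarrow> real set \<Rightarrow> (real \<Rightarrow> 'a cotangent) \<Rightarrow> bool"
  where
  "trajectory H \<phi> I x \<longleftrightarrow>
     (\<forall>t\<in>I. (x has_vector_derivative hamilton_field H \<phi> (x t)) (at t within I))"

section \<open>The boundary value flow\<close>

definition boundary_solution ::
    "('a::euclidean_space cotangent \<Rightarrow> real) \<Rightarrow> 'a one_form \<Rightarrow> real \<Rightarrow> 'a cotangent
      \<Rightarrow> (real \<Rightarrow> 'a cotangent) \<Rightarrow> bool" where
  "boundary_solution H \<phi> h z x \<longleftrightarrow>
     trajectory H \<phi> {0..h} x \<and> fst (x 0) = fst z \<and> snd (x h) = snd z"

text \<open>Only meaningful for \<open>t \<in> {0..h}\<close>, and when solutions exist and are unique on \<open>{0..h}\<close>.\<close>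

definition boundary_flow ::
    "('a::euclidean_space cotangent \<Rightarrow> real) \<Rightarrow> 'a one_form \<Rightarrow> real \<Rightarrow> real
      \<Rightarrow> 'a cotangent \<Rightarrow> 'a cotangent" where
  "boundary_flow H \<phi> h t z = (SOME x. boundary_solution H \<phi> h z x) t"

definition has_boundary_flow ::
    "('a::euclidean_space cotangent \<Rightarrow> real) \<Rightarrow> 'a one_form \<Rightarrow> real \<Rightarrow> bool" where
  "has_boundary_flow H \<phi> h \<longleftrightarrow>
     (\<forall>z. \<exists>x. boundary_solution H \<phi> h z x \<and>
        (\<forall>y. boundary_solution H \<phi> h z y \<longrightarrow> (\<forall>t\<in>{0..h}. y t = x t))) \<and>
     smooth_on ({0..h} \<times> UNIV) (\<lambda>(t, z). boundary_flow H \<phi> h t z)"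

section \<open>The exact forced discrete Hamiltonian system\<close>

definition exact_H ::
    "('a::euclidean_space cotangent \<Rightarrow> real) \<Rightarrow> 'a one_form \<Rightarrow> real \<Rightarrow> 'a cotangent \<Rightarrow> real" where
  "exact_H H \<phi> h z =
     (let q = (\<lambda>t. fst (boundary_flow H \<phi> h t z));
          p = (\<lambda>t. snd (boundary_flow H \<phi> h t z))
      in blinfun_apply (p h) (q h) -
         integral {0..h} (\<lambda>t. blinfun_apply (p t) (vector_derivative q (at t within {0..h}))
                              - H (q t, p t)))"

definition exact_form ::
    "('a::euclidean_space cotangent \<Rightarrow> real) \<Rightarrow> 'a one_form \<Rightarrow> real \<Rightarrow> 'a one_form" where
  "exact_form H \<phi> h z =
     Blinfun (\<lambda>\<delta>. integral {0..h} (\<lambda>t. blinfun_apply (\<phi> (boundary_flow H \<phi> h t z))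
                      (frechet_derivative (boundary_flow H \<phi> h t) (at z) \<delta>)))"

section \<open>Extended trajectories of a forced discrete Hamiltonian system\<close>

definition extended_trajectory ::
    "('a::euclidean_space cotangent \<Rightarrow> real) \<Rightarrow> 'a one_form \<Rightarrow> 'a cotangent list \<Rightarrow> bool" where
  "extended_trajectory Hd \<phi>d zs \<longleftrightarrow>
     (\<forall>k. Suc k < length zs \<longrightarrow>
        (let z = (fst (zs ! k), snd (zs ! Suc k))
         in fst (zs ! Suc k) = of_bidual (D2 Hd z - form_p \<phi>d z) \<and>
            snd (zs ! k) = D1 Hd z - form_q \<phi>d z))"

end

theory Submission
  imports Defs
begin

text \<open>
  Write \<open>(q(t), p(t))\<close> for the boundary value flow at \<open>z = (q\<^sub>0, p\<^sub>1)\<close>. Differentiating the exact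
  discrete Hamiltonian under the integral and integrating \<open>p \<delta>q'\<close> by parts, Hamilton's equations
  cancel everything except the boundary terms and the work of the force:
  \<open>dH\<^sup>E(z)(\<delta>q\<^sub>0, \<delta>p\<^sub>1) = \<delta>p\<^sub>1(q(h)) + p(0)(\<delta>q\<^sub>0) + \<phi>\<^sup>E(z)(\<delta>q\<^sub>0, \<delta>p\<^sub>1)\<close>. Hence the discrete
  equations say exactly that consecutive points are the endpoints of a boundary value solution, and
  both claims follow by uniqueness, respectively by concatenating two such solutions.
\<close>

section \<open>Coordinates on the cotangent space and calculus with operator-valued
  derivatives\<close>

text \<open>The functionals \<open>blinfun_inner_left b\<close> are the dual basis of
  \<open>Basis\<close>, so a linear map on the cotangent space is determined by finitely many
  values.\<close>

lemma cotangent_expansion: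
  fixes v :: "'a::euclidean_space cotangent"
  shows "v = (\<Sum>b\<in>Basis. (fst v \<bullet> b) *\<^sub>R (b, 0)) + (\<Sum>b\<in>Basis. snd v b *\<^sub>R (0, blinfun_inner_left b))"
proof (rule prod_eqI)
  show "fst v = fst ((\<Sum>b\<in>Basis. (fst v \<bullet> b) *\<^sub>R (b, 0)) + (\<Sum>b\<in>Basis. snd v b *\<^sub>R (0, blinfun_inner_left b)))"
    by (simp add: fst_sum euclidean_representation)
  show "snd v = snd ((\<Sum>b\<in>Basis. (fst v \<bullet> b) *\<^sub>R (b, 0)) + (\<Sum>b\<in>Basis. snd v b *\<^sub>R (0, blinfun_inner_left b)))"
  proof (rule blinfun_eqI)
    fix w :: 'a
    have "snd v w = snd v (\<Sum>b\<in>Basis. (w \<bullet> b) *\<^sub>R b)"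
      by (simp add: euclidean_representation)
    also have "\<dots> = (\<Sum>b\<in>Basis. (w \<bullet> b) * snd v b)"
      by (simp only: blinfun.sum_right blinfun.scaleR_right real_scaleR_def)
    finally show "blinfun_apply (snd v) w = blinfun_apply
        (snd ((\<Sum>b\<in>Basis. (fst v \<bullet> b) *\<^sub>R (b, 0)) + (\<Sum>b\<in>Basis. snd v b *\<^sub>R (0, blinfun_inner_left b)))) w"
      by (simp add: snd_sum blinfun.sum_left blinfun.scaleR_left inner_commute mult.commute)
  qed
qed

text \<open>The library's componentwise criterion needs a \<open>euclidean_space\<close> domain, which the dual is not.\<close>

lemma continuous_on_blinfun_cotangent:
  fixes A :: "'x::topological_space \<Rightarrow> 'a::euclidean_space cotangent \<Rightarrow>\<^sub>L 'w::real_normed_vector"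
  assumes "\<And>v. continuous_on S (\<lambda>x. A x v)"
  shows "continuous_on S A"
proof -
  \<comment> \<open>\<open>c b\<close> and \<open>d b\<close> are the coordinate functionals of the
    expansion. They turn \<open>A x\<close> into a finite sum in which only the values of
    \<open>A x\<close> at fixed vectors depend on \<open>x\<close>, so pointwise continuity becomes
    continuity in operator norm.\<close>
  define c :: "'a \<Rightarrow> 'a cotangent \<Rightarrow>\<^sub>L real" where "c b = blinfun_inner_left b o\<^sub>L fst_blinfun" for b
  define d :: "'a \<Rightarrow> 'a cotangent \<Rightarrow>\<^sub>L real" where "d b = to_bidual b o\<^sub>L snd_blinfun" for b
  have c: "c b v = fst v \<bullet> b" and d: "d b v = snd v b" for b v
    by (simp_all add: c_def d_def fst_blinfun.rep_eq snd_blinfun.rep_eq)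
  have "A x = (\<Sum>b\<in>Basis. blinfun_scaleR_left (A x (b, 0)) o\<^sub>L c b)
      + (\<Sum>b\<in>Basis. blinfun_scaleR_left (A x (0, blinfun_inner_left b)) o\<^sub>L d b)" for x
  proof (rule blinfun_eqI)
    fix v
    have "A x v = A x ((\<Sum>b\<in>Basis. (fst v \<bullet> b) *\<^sub>R (b, 0)) + (\<Sum>b\<in>Basis. snd v b *\<^sub>R (0, blinfun_inner_left b)))"
      by (rule arg_cong[OF cotangent_expansion])
    also have "\<dots> = (\<Sum>b\<in>Basis. (fst v \<bullet> b) *\<^sub>R A x (b, 0))
        + (\<Sum>b\<in>Basis. snd v b *\<^sub>R A x (0, blinfun_inner_left b))"
      by (simp only: blinfun.add_right blinfun.sum_right blinfun.scaleR_right)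
    finally show "A x v = ((\<Sum>b\<in>Basis. blinfun_scaleR_left (A x (b, 0)) o\<^sub>L c b)
      + (\<Sum>b\<in>Basis. blinfun_scaleR_left (A x (0, blinfun_inner_left b)) o\<^sub>L d b)) v"
      by (simp add: blinfun.add_left blinfun.sum_left c d)
  qed
  then have A: "A = (\<lambda>x. (\<Sum>b\<in>Basis. blinfun_scaleR_left (A x (b, 0)) o\<^sub>L c b)
      + (\<Sum>b\<in>Basis. blinfun_scaleR_left (A x (0, blinfun_inner_left b)) o\<^sub>L d b))"
    by (rule ext)
  show ?thesis
    by (subst A) (intro continuous_intros assms bounded_linear.continuous_on[OF bounded_linear_blinfun_scaleR_left]
        bounded_bilinear.continuous_on[OF bounded_bilinear_blinfun_compose])
qed

text \<open>Packaging the derivative as a bounded linear map allows continuity in operator norm,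
  composition and integration of derivatives.\<close>

lemma C1_derivative:
  fixes f :: "'a::euclidean_space cotangent \<Rightarrow> 'w::real_normed_vector"
  assumes "C_k_on (Suc k) UNIV f"
  obtains f' where "\<And>z. (f has_derivative blinfun_apply (f' z)) (at z)"
    and "\<And>v. C_k_on k UNIV (\<lambda>z. f' z v)"
proof -
  from assms obtain f' where f': "\<And>z. (f has_derivative f' z) (at z)"
    and C: "\<And>v. C_k_on k UNIV (\<lambda>z. f' z v)"
    by auto
  have "blinfun_apply (Blinfun (f' z)) = f' z" for z
    by (rule bounded_linear_Blinfun_apply[OF has_derivative_bounded_linear[OF f']])
  with f' C that[of "\<lambda>z. Blinfun (f' z)"] show thesis by simp
qed

text \<open>Testing against the dual basis makes the abstract inverse explicit, so that it can be
  differentiated term by term.\<close>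

lemma of_bidual_eq_sum:
  "of_bidual \<xi> = (\<Sum>b\<in>Basis. blinfun_apply \<xi> (blinfun_inner_left b) *\<^sub>R b)"
proof -
  have "(\<Sum>b\<in>Basis. blinfun_apply \<xi> (blinfun_inner_left b) *\<^sub>R b) = of_bidual \<xi>"
  proof (rule euclidean_eqI)
    fix b :: 'a assume "b \<in> Basis"
    have "of_bidual \<xi> \<bullet> b = to_bidual (of_bidual \<xi>) (blinfun_inner_left b)"
      by (simp del: to_bidual_of_bidual)
    then show "(\<Sum>b\<in>Basis. blinfun_apply \<xi> (blinfun_inner_left b) *\<^sub>R b) \<bullet> b = of_bidual \<xi> \<bullet> b"
      using \<open>b \<in> Basis\<close> by (simp add: inner_sum_left inner_Basis if_distrib cong: if_cong)
  qed
  then show ?thesis by simp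
qed

text \<open>The chain rule along the affine embeddings of the two factors through
  \<open>z\<close>.\<close>

lemma
  fixes f :: "'a::euclidean_space cotangent \<Rightarrow> real"
  assumes "(f has_derivative blinfun_apply f') (at z)"
  shows D1_apply: "D1 f z v = f' (v, 0)"
    and D2_apply: "D2 f z \<alpha> = f' (0, \<alpha>)"
proof -
  have "((\<lambda>q. f (q, snd z)) has_derivative (\<lambda>v. f' (v, 0))) (at (fst z))"
    using assms by (auto intro!: derivative_eq_intros has_derivative_compose[where f="\<lambda>q. (q, snd z)" and g=f])
  then show "D1 f z v = f' (v, 0)"
    by (simp add: D1_def bounded_linear_Blinfun_apply has_derivative_bounded_linear flip: frechet_derivative_at)
  have "((\<lambda>p. f (fst z, p)) has_derivative (\<lambda>v. f' (0, v))) (at (snd z))"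
    using assms by (auto intro!: derivative_eq_intros has_derivative_compose[where f="\<lambda>p. (fst z, p)" and g=f])
  then show "D2 f z \<alpha> = f' (0, \<alpha>)"
    by (simp add: D2_def bounded_linear_Blinfun_apply has_derivative_bounded_linear flip: frechet_derivative_at)
qed

text \<open>In coordinates the velocity is a finite sum of first derivatives of \<open>H\<close>, so
  two derivatives of \<open>H\<close> give one of the velocity. Its linearisation \<open>X'\<close>
  governs the variation of the position along the flow.\<close>

lemma velocity_C1:
  fixes H :: "'a::euclidean_space cotangent \<Rightarrow> real"
  assumes "smooth_on UNIV H"
  obtains X' where "\<And>z. ((\<lambda>z. of_bidual (D2 H z)) has_derivative blinfun_apply (X' z)) (at z)"
    and "continuous_on UNIV X'"
proof -
  have "C_k_on (Suc (Suc 0)) UNIV H"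
    using assms by (simp only: smooth_on_def)
  then obtain H' where H': "\<And>z. (H has_derivative blinfun_apply (H' z)) (at z)"
    and C1: "\<And>v. C_k_on (Suc 0) UNIV (\<lambda>z. H' z v)"
    by (rule C1_derivative) blast
  have "\<exists>H''. (\<forall>z. ((\<lambda>z. H' z v) has_derivative blinfun_apply (H'' z)) (at z)) \<and> continuous_on UNIV H''" for v
    using C1_derivative[OF C1[of v]] by (metis C_k_on.simps(1) continuous_on_blinfun_cotangent)
  then obtain H'' where H'': "\<And>v z. ((\<lambda>z. H' z v) has_derivative blinfun_apply (H'' v z)) (at z)"
    and cont: "\<And>v. continuous_on UNIV (H'' v)"
    by metis
  define X' where "X' z = (\<Sum>b\<in>Basis. blinfun_scaleR_left b o\<^sub>L H'' (0, blinfun_inner_left b) z)" for z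
  have X: "of_bidual (D2 H z) = (\<Sum>b\<in>Basis. H' z (0, blinfun_inner_left b) *\<^sub>R b)" for z
    by (simp add: of_bidual_eq_sum D2_apply[OF H'])
  show thesis
  proof (rule that[of X'])
    show "((\<lambda>z. of_bidual (D2 H z)) has_derivative blinfun_apply (X' z)) (at z)" for z
    proof -
      have "((\<lambda>z. \<Sum>b\<in>Basis. H' z (0, blinfun_inner_left b) *\<^sub>R b) has_derivative
          (\<lambda>v. \<Sum>b\<in>Basis. H'' (0, blinfun_inner_left b) z v *\<^sub>R b)) (at z)"
        by (intro has_derivative_sum has_derivative_scaleR_left H'')
      then show ?thesis
        unfolding X by (rule has_derivative_eq_rhs) (auto simp: fun_eq_iff X'_def blinfun.sum_left)
    qed
    show "continuous_on UNIV X'"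
      unfolding X'_def
      by (intro continuous_intros cont bounded_bilinear.continuous_on[OF bounded_bilinear_blinfun_compose])
  qed
qed

section \<open>The boundary value flow and its derivative in the boundary data\<close>

text \<open>The choice inside \<open>boundary_flow\<close> does not depend on \<open>t\<close>, so
  for fixed \<open>z\<close> all its values lie on one chosen solution.\<close>

lemma has_boundary_flowD:
  assumes "has_boundary_flow H \<phi> h"
  shows boundary_solution_flow: "boundary_solution H \<phi> h z (\<lambda>t. boundary_flow H \<phi> h t z)"
    and boundary_flow_unique:
      "\<lbrakk>boundary_solution H \<phi> h z y; t \<in> {0..h}\<rbrakk> \<Longrightarrow> y t = boundary_flow H \<phi> h t z"
proof -
  have flow: "(\<lambda>t. boundary_flow H \<phi> h t z) = (SOME x. boundary_solution H \<phi> h z x)"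
    by (rule ext) (simp add: boundary_flow_def)
  obtain x where x: "boundary_solution H \<phi> h z x"
    and uniq: "\<And>y t. \<lbrakk>boundary_solution H \<phi> h z y; t \<in> {0..h}\<rbrakk> \<Longrightarrow> y t = x t"
    using assms unfolding has_boundary_flow_def by metis
  show sol: "boundary_solution H \<phi> h z (\<lambda>t. boundary_flow H \<phi> h t z)"
    unfolding flow by (rule someI[of "boundary_solution H \<phi> h z", OF x])
  show "y t = boundary_flow H \<phi> h t z" if "boundary_solution H \<phi> h z y" "t \<in> {0..h}" for y t
    using uniq[OF that] uniq[OF sol that(2)] by simp
qed

text \<open>Joint smoothness on the strip is restricted to a slice of constant time. The order of
  arguments, boundary data before time, is the one used for differentiation under the
  integral.\<close>

lemma boundary_flow_derivative:
  fixes H :: "'a::euclidean_space cotangent \<Rightarrow> real"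
  assumes "has_boundary_flow H \<phi> h"
  obtains A where "\<And>t z. t \<in> {0..h} \<Longrightarrow> (boundary_flow H \<phi> h t has_derivative blinfun_apply (A z t)) (at z)"
    and "continuous_on (UNIV \<times> {0..h}) (\<lambda>(z, t). A z t)"
proof -
  let ?F = "\<lambda>(t, z). boundary_flow H \<phi> h t z"
  let ?S = "{0..h} \<times> (UNIV :: 'a cotangent set)"
  have "C_k_on (Suc 0) ?S ?F"
    using assms unfolding has_boundary_flow_def smooth_on_def by blast
  then obtain F' where F': "\<And>x. x \<in> ?S \<Longrightarrow> (?F has_derivative F' x) (at x within ?S)"
    and cont: "\<And>v. continuous_on ?S (\<lambda>x. F' x v)"
    by auto
  define A where "A z t = Blinfun (\<lambda>v. F' (t, z) (0, v))" for z t
  have der: "(boundary_flow H \<phi> h t has_derivative (\<lambda>v. F' (t, z) (0, v))) (at z)" if "t \<in> {0..h}" for t z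
  proof -
    \<comment> \<open>The slice at time \<open>t\<close> is the image of the whole space under
      \<open>Pair t\<close>. The derivative within the strip therefore yields a derivative at
      \<open>z\<close> that is not one-sided, also for \<open>t = 0\<close> and
      \<open>t = h\<close>.\<close>
    have 1: "(Pair t has_derivative (\<lambda>v. (0, v))) (at z within UNIV)"
      by (auto intro!: derivative_eq_intros)
    have 2: "(?F has_derivative F' (t, z)) (at (t, z) within Pair t ` UNIV)"
      by (rule has_derivative_subset[OF F']) (use that in auto)
    show ?thesis
      using diff_chain_within[OF 1 2] by (simp add: o_def)
  qed
  have A: "blinfun_apply (A z t) = (\<lambda>v. F' (t, z) (0, v))" if "t \<in> {0..h}" for t z
    unfolding A_def by (rule bounded_linear_Blinfun_apply[OF has_derivative_bounded_linear[OF der[OF that]]])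
  show thesis
  proof (rule that[of A])
    show "(boundary_flow H \<phi> h t has_derivative blinfun_apply (A z t)) (at z)" if "t \<in> {0..h}" for t z
      using der A that by simp
    have "continuous_on (UNIV \<times> {0..h}) (\<lambda>x. case x of (z, t) \<Rightarrow> blinfun_apply (A z t) v)" for v
    proof -
      have "continuous_on (UNIV \<times> {0..h}) (\<lambda>x. F' (snd x, fst x) (0, v))"
        by (rule continuous_on_compose2[OF cont[of "(0, v)"]]) (auto intro!: continuous_intros)
      then show ?thesis
        by (rule continuous_on_eq) (auto simp: A)
    qed
    then show "continuous_on (UNIV \<times> {0..h}) (\<lambda>(z, t). A z t)"
      by (intro continuous_on_blinfun_cotangent) (simp add: case_prod_unfold)
  qed
qed

section \<open>Translating and joining trajectories\<close>

text \<open>The Hamilton field is autonomous; the condition on \<open>J\<close> covers restriction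
  to a smaller set as well.\<close>

lemma trajectory_shift:
  assumes "trajectory H \<phi> I x" and "\<And>t. t \<in> J \<Longrightarrow> t + c \<in> I"
  shows "trajectory H \<phi> J (\<lambda>t. x (t + c))"
  unfolding trajectory_def
proof
  fix t assume "t \<in> J"
  have 1: "((\<lambda>t. t + c) has_vector_derivative 1) (at t within J)"
    by (auto intro!: derivative_eq_intros)
  have "(x has_vector_derivative hamilton_field H \<phi> (x (t + c))) (at (t + c) within (\<lambda>t. t + c) ` J)"
    using assms \<open>t \<in> J\<close> unfolding trajectory_def
    by (meson has_vector_derivative_within_subset image_subsetI)
  from vector_diff_chain_within[OF 1 this]
  show "((\<lambda>t. x (t + c)) has_vector_derivative hamilton_field H \<phi> (x (t + c))) (at t within J)"
    by (simp add: o_def)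
qed

text \<open>At the junction both one-sided derivatives are the field at the common point, hence they
  agree.\<close>

lemma trajectory_concat:
  assumes "trajectory H \<phi> {a..b} x" and "trajectory H \<phi> {b..c} y" and "x b = y b" and "a \<le> b" "b \<le> c"
  shows "trajectory H \<phi> {a..c} (\<lambda>t. if t \<in> {a..b} then x t else y t)"
  unfolding trajectory_def
proof
  fix t assume t: "t \<in> {a..c}"
  have "((\<lambda>t. if t \<in> {a..b} then x t else y t) has_vector_derivative
      (if t \<in> {a..b} then hamilton_field H \<phi> (x t) else hamilton_field H \<phi> (y t))) (at t within {a..c})"
  proof (rule has_vector_derivative_If_within_closures[where T = "{b..c}"])
    have *: "{a..b} \<union> (closure {a..b} \<inter> closure {b..c}) = {a..b}"
        "{b..c} \<union> (closure {a..b} \<inter> closure {b..c}) = {b..c}"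
      using assms(4,5) by auto
    show "(x has_vector_derivative hamilton_field H \<phi> (x t)) (at t within {a..b} \<union> (closure {a..b} \<inter> closure {b..c}))"
      if "t \<in> {a..b} \<union> (closure {a..b} \<inter> closure {b..c})"
      using that assms(1) unfolding * trajectory_def by blast
    show "(y has_vector_derivative hamilton_field H \<phi> (y t)) (at t within {b..c} \<union> (closure {a..b} \<inter> closure {b..c}))"
      if "t \<in> {b..c} \<union> (closure {a..b} \<inter> closure {b..c})"
      using that assms(2) unfolding * trajectory_def by blast
  qed (use t assms in \<open>auto dest: order_antisym\<close>)
  then show "((\<lambda>t. if t \<in> {a..b} then x t else y t) has_vector_derivative
      hamilton_field H \<phi> (if t \<in> {a..b} then x t else y t)) (at t within {a..c})"
    by (simp add: if_distrib[of "hamilton_field H \<phi>"])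
qed

section \<open>The differential of the exact discrete Hamiltonian\<close>

text \<open>For zero force this is the classical fact that the exact discrete Hamiltonian is a type
  II generating function of the time-\<open>h\<close> flow; the force adds its work along the
  variation.\<close>

proposition exact_H_derivative:
  fixes H :: "'a::euclidean_space cotangent \<Rightarrow> real"
  assumes sys: "forced_hamiltonian_system H \<phi>" and h: "h > 0" and flow: "has_boundary_flow H \<phi> h"
  obtains E where "(exact_H H \<phi> h has_derivative blinfun_apply E) (at z)"
    and "\<And>v. blinfun_apply E v = blinfun_apply (snd v) (fst (boundary_flow H \<phi> h h z))
      + blinfun_apply (snd (boundary_flow H \<phi> h 0 z)) (fst v) + blinfun_apply (exact_form H \<phi> h z) v"
proof -
  define F where "F z t = boundary_flow H \<phi> h t z" for z t
  define X where "X y = of_bidual (D2 H y)" for y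
  have smooth_H: "smooth_on UNIV H" and smooth_\<phi>: "smooth_on UNIV \<phi>" and hor: "horizontal \<phi>"
    using sys by (auto simp: forced_hamiltonian_system_def)
  obtain X' where X': "\<And>y. (X has_derivative blinfun_apply (X' y)) (at y)"
    and cont_X': "continuous_on UNIV X'"
    unfolding X_def using velocity_C1[OF smooth_H] by blast
  have "C_k_on (Suc 0) UNIV H"
    using smooth_H by (simp only: smooth_on_def)
  then obtain H' where H': "\<And>y. (H has_derivative blinfun_apply (H' y)) (at y)"
    and "\<And>v. C_k_on 0 UNIV (\<lambda>y. H' y v)"
    by (rule C1_derivative) blast
  then have cont_H': "continuous_on UNIV H'"
    by (intro continuous_on_blinfun_cotangent) simp
  have "C_k_on 0 UNIV \<phi>"
    using smooth_\<phi> unfolding smooth_on_def by blast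
  then have cont_\<phi>: "continuous_on UNIV \<phi>"
    by simp
  obtain A where A: "\<And>t z. t \<in> {0..h} \<Longrightarrow> ((\<lambda>z. F z t) has_derivative blinfun_apply (A z t)) (at z)"
    and cont_A: "continuous_on (UNIV \<times> {0..h}) (\<lambda>(z, t). A z t)"
    using boundary_flow_derivative[OF flow] unfolding F_def by (metis (no_types, lifting) ext)
  have sol: "boundary_solution H \<phi> h z (F z)" for z
    using boundary_solution_flow[OF flow] by (simp add: F_def[abs_def])
  have F0: "fst (F z 0) = fst z" and Fh: "snd (F z h) = snd z" for z
    using sol[of z] by (auto simp: boundary_solution_def)
  have traj: "(F z has_vector_derivative hamilton_field H \<phi> (F z t)) (at t within {0..h})"
    if "t \<in> {0..h}" for z t
    using sol[of z] that by (auto simp: boundary_solution_def trajectory_def)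
  have dQ: "((\<lambda>t. fst (F z t)) has_vector_derivative X (F z t)) (at t within {0..h})"
    if "t \<in> {0..h}" for z t
    using bounded_linear.has_vector_derivative[OF bounded_linear_fst traj[OF that, of z]]
    by (simp add: hamilton_field_def X_def)
  have dP: "((\<lambda>t. snd (F z t)) has_vector_derivative (- D1 H (F z t) + form_q \<phi> (F z t))) (at t within {0..h})"
    if "t \<in> {0..h}" for z t
    using bounded_linear.has_vector_derivative[OF bounded_linear_snd traj[OF that, of z]]
    by (simp add: hamilton_field_def)
  have cont_F: "continuous_on (UNIV \<times> {0..h}) (\<lambda>(z, t). F z t)"
  proof -
    have "C_k_on 0 ({0..h} \<times> UNIV) (\<lambda>(t, z). F z t)"
      using flow unfolding has_boundary_flow_def smooth_on_def F_def by blast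
    then have "continuous_on ({0..h} \<times> UNIV) (\<lambda>x. F (snd x) (fst x))"
      by (simp add: case_prod_unfold)
    moreover have "prod.swap ` (UNIV \<times> {0..h}) \<subseteq> {0..h} \<times> (UNIV :: 'a cotangent set)"
      by auto
    ultimately show ?thesis
      using continuous_on_compose2[OF _ continuous_on_swap] by (fastforce simp: case_prod_unfold)
  qed
  have slice: "continuous_on S (f z)" if "continuous_on (UNIV \<times> S) (\<lambda>(z, t). f z t)"
    for f :: "'a cotangent \<Rightarrow> real \<Rightarrow> 'w::topological_space" and S z
  proof -
    have "continuous_on S (Pair z)" "Pair z ` S \<subseteq> UNIV \<times> S"
      by (auto intro!: continuous_intros)
    from continuous_on_compose2[OF that this] show ?thesis
      by simp
  qed
  have cont_Fz: "continuous_on {0..h} (F z)" and cont_Az: "continuous_on {0..h} (A z)" for z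
    using slice[OF cont_F] slice[OF cont_A] by auto
  have X_cont: "continuous_on UNIV X"
    by (rule has_derivative_continuous_on) (rule has_derivative_at_withinI[OF X'])

  text \<open>The variational equation is obtained by differentiating the integrated equation for \<open>q\<close>: this
    avoids mixed partial derivatives of the flow.\<close>
  have varQ: "((\<lambda>t. fst (A z t v)) has_vector_derivative X' (F z t) (A z t v)) (at t within {0..h})"
    if t: "t \<in> {0..h}" for z t v
  proof -
    have eq: "fst (A z s v) = fst v + integral {0..s} (\<lambda>r. X' (F z r) (A z r v))" if s: "s \<in> {0..h}" for s
    proof -
      have sub: "{0..s} \<subseteq> {0..h}"
        using s by auto
      have int: "fst (F z s) = fst z + integral {0..s} (\<lambda>r. X (F z r))" for z
      proof -
        have "((\<lambda>r. X (F z r)) has_integral (fst (F z s) - fst (F z 0))) {0..s}"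
          by (rule fundamental_theorem_of_calculus)
            (use s sub in \<open>auto intro: has_vector_derivative_within_subset[OF dQ]\<close>)
        then show ?thesis
          by (auto simp: F0 dest: integral_unique)
      qed
      have cont: "continuous_on (UNIV \<times> {0..s}) (\<lambda>(z, r). X' (F z r) o\<^sub>L A z r)"
        using sub unfolding case_prod_unfold
        by (intro bounded_bilinear.continuous_on[OF bounded_bilinear_blinfun_compose]
            continuous_on_compose2[OF cont_X'] continuous_on_subset[OF cont_F[unfolded case_prod_unfold]]
            continuous_on_subset[OF cont_A[unfolded case_prod_unfold]]) auto
      have "((\<lambda>z. integral (cbox 0 s) (\<lambda>r. X (F z r))) has_derivative
          blinfun_apply (integral (cbox 0 s) (\<lambda>r. X' (F z r) o\<^sub>L A z r))) (at z within UNIV)"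
      proof (rule leibniz_rule)
        show "((\<lambda>z. X (F z r)) has_derivative blinfun_apply (X' (F z r) o\<^sub>L A z r)) (at z within UNIV)"
          if "r \<in> cbox 0 s" for z r
          using has_derivative_compose[OF A X'] that sub by (auto simp: blinfun_compose.rep_eq o_def)
        show "(\<lambda>r. X (F z r)) integrable_on cbox 0 s" for z
          using sub by (auto intro!: integrable_continuous_real continuous_on_compose2[OF X_cont]
              continuous_on_subset[OF cont_Fz])
      qed (use cont in auto)
      then have "((\<lambda>z. fst z + integral {0..s} (\<lambda>r. X (F z r))) has_derivative
          (\<lambda>v. fst v + blinfun_apply (integral {0..s} (\<lambda>r. X' (F z r) o\<^sub>L A z r)) v)) (at z)"
        by (auto intro!: derivative_eq_intros)
      then have "((\<lambda>z. fst (F z s)) has_derivative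
          (\<lambda>v. fst v + blinfun_apply (integral {0..s} (\<lambda>r. X' (F z r) o\<^sub>L A z r)) v)) (at z)"
        by (simp only: int)
      \<comment> \<open>The same map is now differentiated directly through the flow; uniqueness of
        derivatives gives the integrated variational equation.\<close>
      moreover have "((\<lambda>z. fst (F z s)) has_derivative (\<lambda>v. fst (A z s v))) (at z)"
        using A[OF s, of z] by (auto intro!: derivative_eq_intros)
      ultimately have "fst (A z s v) = fst v + blinfun_apply (integral {0..s} (\<lambda>r. X' (F z r) o\<^sub>L A z r)) v"
        by (rule fun_cong[OF has_derivative_unique, rotated])
      also have "blinfun_apply (integral {0..s} (\<lambda>r. X' (F z r) o\<^sub>L A z r)) v
          = integral {0..s} (\<lambda>r. X' (F z r) (A z r v))"
        using integrable_continuous_real[OF slice[OF cont]] by (simp add: blinfun_apply_integral)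
      finally show ?thesis .
    qed
    have "continuous_on {0..h} (\<lambda>r. X' (F z r) (A z r v))"
      by (intro continuous_intros continuous_on_compose2[OF cont_X'] cont_Fz cont_Az) auto
    from integral_has_vector_derivative[OF this t]
    have "((\<lambda>s. fst v + integral {0..s} (\<lambda>r. X' (F z r) (A z r v))) has_vector_derivative
        X' (F z t) (A z t v)) (at t within {0..h})"
      by (auto intro!: derivative_eq_intros)
    then show ?thesis
      by (rule has_vector_derivative_transform[OF t, rotated]) (simp add: eq)
  qed

  \<comment> \<open>\<open>g\<close> is the action integrand, with the velocity replaced by
    \<open>X\<close>.\<close>
  define g where "g y = snd y (X y) - H y" for y
  define K :: "'a cotangent \<Rightarrow>\<^sub>L 'a cotangent" where "K = Blinfun (\<lambda>w. (fst w, 0))"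
  have K: "K w = (fst w, 0)" for w
    unfolding K_def by (subst bounded_linear_Blinfun_apply) (auto intro!: bounded_linear_intros bounded_linear_Pair)
  \<comment> \<open>Varying the momentum contributes \<open>snd w (X y)\<close> through the pairing
    and the same term through \<open>H\<close>, because \<open>X\<close> represents
    \<open>D2 H\<close>. These cancel, so \<open>H'\<close> enters only through the position part,
    selected by \<open>K\<close>.\<close>
  define g' where "g' y = (snd y o\<^sub>L X' y) - (H' y o\<^sub>L K)" for y
  have g'_apply: "g' y w = snd y (X' y w) - D1 H y (fst w)" for y w
    by (simp add: g'_def blinfun.diff_left K D1_apply[OF H'])
  have g': "(g has_derivative blinfun_apply (g' y)) (at y)" for y
  proof -
    have "((\<lambda>y. snd y (X y)) has_derivative (\<lambda>w. snd y (X' y w) + snd w (X y))) (at y)"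
      by (rule bounded_bilinear.FDERIV[OF bounded_bilinear_blinfun_apply])
        (auto intro!: derivative_eq_intros X')
    from has_derivative_diff[OF this H']
    have dg: "(g has_derivative (\<lambda>w. snd y (X' y w) + snd w (X y) - H' y w)) (at y)"
      by (simp add: g_def[abs_def])
    have H'_eq: "H' y w = D1 H y (fst w) + snd w (X y)" for w
    proof -
      have "H' y w = H' y (fst w, 0) + H' y (0, snd w)"
        by (simp flip: blinfun.add_right)
      also have "H' y (0, snd w) = to_bidual (X y) (snd w)"
        unfolding X_def to_bidual_of_bidual by (simp add: D2_apply[OF H'])
      finally show ?thesis
        by (simp add: D1_apply[OF H'])
    qed
    show ?thesis
      by (rule has_derivative_eq_rhs[OF dg]) (simp add: fun_eq_iff g'_apply H'_eq)
  qed
  have cont_g: "continuous_on UNIV g"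
    by (rule has_derivative_continuous_on) (rule has_derivative_at_withinI[OF g'])
  have cont_g': "continuous_on UNIV g'"
    unfolding g'_def
    by (intro continuous_intros cont_X' cont_H' bounded_bilinear.continuous_on[OF bounded_bilinear_blinfun_compose])

  \<comment> \<open>Along a solution the velocity equals \<open>X\<close>, so the action is an
    integral of a function of the flow alone and can be differentiated in \<open>z\<close> under the
    integral.\<close>
  have exact_H: "exact_H H \<phi> h = (\<lambda>z. snd z (fst (F z h)) - integral (cbox 0 h) (\<lambda>t. g (F z t)))"
  proof
    fix z
    have "integral {0..h} (\<lambda>t. snd (F z t) (vector_derivative (\<lambda>t. fst (F z t)) (at t within {0..h}))
        - H (fst (F z t), snd (F z t))) = integral {0..h} (\<lambda>t. g (F z t))"
      by (rule integral_cong) (simp add: g_def vector_derivative_within_closed_interval[OF h _ dQ])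
    then show "exact_H H \<phi> h z = snd z (fst (F z h)) - integral (cbox 0 h) (\<lambda>t. g (F z t))"
      by (simp add: exact_H_def Let_def Fh flip: F_def)
  qed
  have cont_gA: "continuous_on (UNIV \<times> cbox 0 h) (\<lambda>(z, t). g' (F z t) o\<^sub>L A z t)"
    unfolding case_prod_unfold box_real
    by (intro bounded_bilinear.continuous_on[OF bounded_bilinear_blinfun_compose]
        continuous_on_compose2[OF cont_g'] cont_F[unfolded case_prod_unfold] cont_A[unfolded case_prod_unfold]) auto
  have der_int: "((\<lambda>z. integral (cbox 0 h) (\<lambda>t. g (F z t))) has_derivative
      blinfun_apply (integral (cbox 0 h) (\<lambda>t. g' (F z t) o\<^sub>L A z t))) (at z within UNIV)"
  proof (rule leibniz_rule)
    show "((\<lambda>z. g (F z t)) has_derivative blinfun_apply (g' (F z t) o\<^sub>L A z t)) (at z within UNIV)"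
      if "t \<in> cbox 0 h" for z t
      using has_derivative_compose[OF A g'] that by (auto simp: blinfun_compose.rep_eq o_def)
    show "(\<lambda>t. g (F z t)) integrable_on cbox 0 h" for z
      by (auto intro!: integrable_continuous_real continuous_on_compose2[OF cont_g] cont_Fz)
  qed (use cont_gA in auto)

  have cont_\<phi>A: "continuous_on {0..h} (\<lambda>t. \<phi> (F z t) o\<^sub>L A z t)"
    by (intro bounded_bilinear.continuous_on[OF bounded_bilinear_blinfun_compose]
        continuous_on_compose2[OF cont_\<phi>] cont_Fz cont_Az) auto
  have exact_form: "exact_form H \<phi> h z v = integral {0..h} (\<lambda>t. \<phi> (F z t) (A z t v))" for v
  proof -
    \<comment> \<open>The function under \<open>Blinfun\<close> in \<open>exact_form\<close> is the
      action of an integral of operators, hence bounded linear, and \<open>Blinfun\<close> returns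
      that operator.\<close>
    have eq: "integral {0..h} (\<lambda>t. \<phi> (F z t) (frechet_derivative (boundary_flow H \<phi> h t) (at z) v))
        = blinfun_apply (integral {0..h} (\<lambda>t. \<phi> (F z t) o\<^sub>L A z t)) v" for v
      unfolding blinfun_apply_integral[OF integrable_continuous_real[OF cont_\<phi>A]]
    proof (rule integral_cong)
      fix t assume "t \<in> {0..h}"
      from A[OF this, of z] show "\<phi> (F z t) (frechet_derivative (boundary_flow H \<phi> h t) (at z) v)
          = (\<phi> (F z t) o\<^sub>L A z t) v"
        unfolding F_def by (simp flip: frechet_derivative_at)
    qed
    have "exact_form H \<phi> h z = integral {0..h} (\<lambda>t. \<phi> (F z t) o\<^sub>L A z t)"
      by (simp only: exact_form_def F_def[symmetric] eq blinfun_apply_inverse)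
    then show ?thesis
      by (simp add: blinfun_apply_integral[OF integrable_continuous_real[OF cont_\<phi>A]])
  qed

  \<comment> \<open>Integration by parts: the time derivative of the pairing of momentum with the
    varied position is the sum of both integrands, by the momentum equation and
    \<open>varQ\<close>.\<close>
  have parts: "integral {0..h} (\<lambda>t. g' (F z t) (A z t v)) + integral {0..h} (\<lambda>t. \<phi> (F z t) (A z t v))
      = snd z (fst (A z h v)) - snd (F z 0) (fst v)" for v
  proof -
    have "((\<lambda>t. snd (F z t) (fst (A z t v))) has_vector_derivative
        g' (F z t) (A z t v) + \<phi> (F z t) (A z t v)) (at t within {0..h})" if t: "t \<in> {0..h}" for t
    proof -
      \<comment> \<open>Horizontality lets the one-form see only the position part of the variation,
        which is what the force in the momentum equation pairs with.\<close>
      have "\<phi> (F z t) (A z t v) = \<phi> (F z t) (fst (A z t v), 0)"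
        using hor unfolding horizontal_def by (metis form_q_apply prod.collapse)
      with bounded_bilinear.has_vector_derivative[OF bounded_bilinear_blinfun_apply dP[OF t, of z] varQ[OF t, of z v]]
      show ?thesis
        by (simp add: g'_apply blinfun.diff_left algebra_simps)
    qed
    then have total: "((\<lambda>t. g' (F z t) (A z t v) + \<phi> (F z t) (A z t v)) has_integral
        snd (F z h) (fst (A z h v)) - snd (F z 0) (fst (A z 0 v))) {0..h}"
      using h by (intro fundamental_theorem_of_calculus) auto
    \<comment> \<open>The initial position is prescribed as \<open>fst z\<close>, so its variation
      is \<open>fst v\<close>.\<close>
    have A0: "fst (A z 0 v) = fst v"
    proof -
      have "((\<lambda>z. fst (F z 0)) has_derivative (\<lambda>v. fst (A z 0 v))) (at z)"
        using A[of 0 z] h by (auto intro!: derivative_eq_intros)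
      moreover have "((\<lambda>z. fst (F z 0)) has_derivative fst) (at z)"
        unfolding F0 by (auto intro!: derivative_eq_intros)
      ultimately show ?thesis
        by (rule fun_cong[OF has_derivative_unique])
    qed
    have "continuous_on {0..h} (\<lambda>t. g' (F z t))" "continuous_on {0..h} (\<lambda>t. \<phi> (F z t))"
      by (rule continuous_on_compose2[OF cont_g' cont_Fz] continuous_on_compose2[OF cont_\<phi> cont_Fz]; simp)+
    then have "(\<lambda>t. g' (F z t) (A z t v)) integrable_on {0..h}" "(\<lambda>t. \<phi> (F z t) (A z t v)) integrable_on {0..h}"
      by (auto intro!: integrable_continuous_real continuous_intros cont_Az)
    from integral_add[OF this] integral_unique[OF total] show ?thesis
      by (simp only: A0 Fh)
  qed

  let ?E = "\<lambda>v. blinfun_apply (snd v) (fst (F z h)) + snd (F z 0) (fst v) + exact_form H \<phi> h z v"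
  \<comment> \<open>The product rule on the boundary term produces
    \<open>snd z (fst (A z h v))\<close>, which cancels against the upper boundary term in
    \<open>parts\<close>.\<close>
  have "((\<lambda>z. snd z (fst (F z h))) has_derivative (\<lambda>v. snd z (fst (A z h v)) + blinfun_apply (snd v) (fst (F z h)))) (at z)"
    using A[of h z] h
    by (intro bounded_bilinear.FDERIV[OF bounded_bilinear_blinfun_apply]) (auto intro!: derivative_eq_intros)
  from has_derivative_diff[OF this der_int]
  have "(exact_H H \<phi> h has_derivative (\<lambda>v. snd z (fst (A z h v)) + blinfun_apply (snd v) (fst (F z h))
      - blinfun_apply (integral (cbox 0 h) (\<lambda>t. g' (F z t) o\<^sub>L A z t)) v)) (at z)"
    by (simp add: exact_H)
  moreover have "blinfun_apply (integral (cbox 0 h) (\<lambda>t. g' (F z t) o\<^sub>L A z t)) v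
      = integral {0..h} (\<lambda>t. g' (F z t) (A z t v))" for v
    using integrable_continuous_real[OF slice[OF cont_gA[unfolded box_real]]] by (simp add: blinfun_apply_integral)
  moreover have "snd z (fst (A z h v)) + blinfun_apply (snd v) (fst (F z h)) - integral {0..h} (\<lambda>t. g' (F z t) (A z t v)) = ?E v" for v
    using parts[of v] by (simp add: exact_form)
  ultimately have E: "(exact_H H \<phi> h has_derivative ?E) (at z)"
    by (simp only:)
  have "blinfun_apply (Blinfun ?E) = ?E"
    by (rule bounded_linear_Blinfun_apply[OF has_derivative_bounded_linear[OF E]])
  with E that[of "Blinfun ?E"] show thesis
    by (simp add: F_def)
qed

section \<open>The discrete equations as boundary conditions on the flow\<close>

text \<open>Evaluating the differential on \<open>(v, 0)\<close> or on \<open>(0, \<alpha>)\<close>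
  kills one boundary term, and subtracting the one-form removes the work of the force.\<close>

lemma
  fixes H :: "'a::euclidean_space cotangent \<Rightarrow> real"
  assumes "forced_hamiltonian_system H \<phi>" and "h > 0" and "has_boundary_flow H \<phi> h"
  shows D1_exact_H: "D1 (exact_H H \<phi> h) z - form_q (exact_form H \<phi> h) z = snd (boundary_flow H \<phi> h 0 z)"
    and D2_exact_H: "D2 (exact_H H \<phi> h) z - form_p (exact_form H \<phi> h) z
      = to_bidual (fst (boundary_flow H \<phi> h h z))"
proof -
  obtain E where E: "(exact_H H \<phi> h has_derivative blinfun_apply E) (at z)"
    and E_apply: "\<And>v. blinfun_apply E v = blinfun_apply (snd v) (fst (boundary_flow H \<phi> h h z))
      + blinfun_apply (snd (boundary_flow H \<phi> h 0 z)) (fst v) + blinfun_apply (exact_form H \<phi> h z) v"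
    using exact_H_derivative[OF assms] by blast
  show "D1 (exact_H H \<phi> h) z - form_q (exact_form H \<phi> h) z = snd (boundary_flow H \<phi> h 0 z)"
    by (rule blinfun_eqI) (simp add: blinfun.diff_left D1_apply[OF E] E_apply)
  show "D2 (exact_H H \<phi> h) z - form_p (exact_form H \<phi> h) z = to_bidual (fst (boundary_flow H \<phi> h h z))"
    by (rule blinfun_eqI) (simp add: blinfun.diff_left D2_apply[OF E] E_apply)
qed

text \<open>The discrete equations supply the initial momentum and the final position; the boundary
  conditions of the flow supply the other two components.\<close>

lemma extended_trajectory_exact_iff:
  fixes H :: "'a::euclidean_space cotangent \<Rightarrow> real"
  assumes "forced_hamiltonian_system H \<phi>" and "h > 0" and "has_boundary_flow H \<phi> h"
  shows "extended_trajectory (exact_H H \<phi> h) (exact_form H \<phi> h) zs \<longleftrightarrow>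
    (\<forall>k. Suc k < length zs \<longrightarrow>
      boundary_flow H \<phi> h 0 (fst (zs ! k), snd (zs ! Suc k)) = zs ! k \<and>
      boundary_flow H \<phi> h h (fst (zs ! k), snd (zs ! Suc k)) = zs ! Suc k)"
proof -
  have "fst (boundary_flow H \<phi> h 0 z) = fst z" "snd (boundary_flow H \<phi> h h z) = snd z" for z
    using boundary_solution_flow[OF assms(3), of z] by (auto simp: boundary_solution_def)
  then show ?thesis
    unfolding extended_trajectory_def Let_def D1_exact_H[OF assms] D2_exact_H[OF assms]
    by (auto simp: prod_eq_iff)
qed

theorem proposition5p4:
  fixes H :: "'a::euclidean_space cotangent \<Rightarrow> real"
    and \<phi> :: "'a one_form"
    and h :: real
  assumes "forced_hamiltonian_system H \<phi>"
    and "h > 0"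
    and "has_boundary_flow H \<phi> h"
  shows "(\<forall>I q p. is_interval I \<and> {0..2 * h} \<subseteq> I \<and> trajectory H \<phi> I (\<lambda>t. (q t, p t)) \<longrightarrow>
            extended_trajectory (exact_H H \<phi> h) (exact_form H \<phi> h)
              [(q 0, p 0), (q h, p h), (q (2 * h), p (2 * h))]) \<and>
         (\<forall>q0 p0 q1 p1 q2 p2.
            extended_trajectory (exact_H H \<phi> h) (exact_form H \<phi> h) [(q0, p0), (q1, p1), (q2, p2)] \<longrightarrow>
            (\<exists>q p. trajectory H \<phi> {0..2 * h} (\<lambda>t. (q t, p t)) \<and>
               (q 0, p 0) = (q0, p0) \<and> (q h, p h) = (q1, p1) \<and> (q (2 * h), p (2 * h)) = (q2, p2)))"
proof (intro conjI allI impI)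
  fix I q p
  assume I: "is_interval I \<and> {0..2 * h} \<subseteq> I \<and> trajectory H \<phi> I (\<lambda>t. (q t, p t))"
  \<comment> \<open>Used with \<open>c = 0\<close> and \<open>c = h\<close>: each half of the
    trajectory, moved to start at time 0, solves the boundary value problem with its own end data
    and equals the flow by uniqueness.\<close>
  have step: "boundary_flow H \<phi> h 0 (q c, p (c + h)) = (q c, p c) \<and>
      boundary_flow H \<phi> h h (q c, p (c + h)) = (q (c + h), p (c + h))" if "c \<in> {0..h}" for c
  proof -
    have "trajectory H \<phi> {0..h} (\<lambda>t. (q (t + c), p (t + c)))"
    proof (rule trajectory_shift[where x = "\<lambda>t. (q t, p t)"])
      show "trajectory H \<phi> I (\<lambda>t. (q t, p t))"
        using I by blast
      show "t + c \<in> I" if "t \<in> {0..h}" for t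
        using that \<open>c \<in> {0..h}\<close> I by (auto intro!: subsetD[of "{0..2 * h}" I])
    qed
    then have sol: "boundary_solution H \<phi> h (q c, p (c + h)) (\<lambda>t. (q (t + c), p (t + c)))"
      by (simp add: boundary_solution_def add.commute)
    have "boundary_flow H \<phi> h t (q c, p (c + h)) = (q (t + c), p (t + c))" if "t \<in> {0..h}" for t
      by (rule boundary_flow_unique[OF assms(3) sol that, symmetric])
    from this[of 0] this[of h] show ?thesis
      using assms(2) by (simp add: add.commute)
  qed
  show "extended_trajectory (exact_H H \<phi> h) (exact_form H \<phi> h)
      [(q 0, p 0), (q h, p h), (q (2 * h), p (2 * h))]"
    using step[of 0] step[of h] assms(2)
    by (auto simp: extended_trajectory_exact_iff[OF assms] less_Suc_eq)
next
  fix q0 p0 q1 p1 q2 p2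
  assume "extended_trajectory (exact_H H \<phi> h) (exact_form H \<phi> h) [(q0, p0), (q1, p1), (q2, p2)]"
  note * = this[unfolded extended_trajectory_exact_iff[OF assms], rule_format]
  have ends: "boundary_flow H \<phi> h 0 (q0, p1) = (q0, p0)" "boundary_flow H \<phi> h h (q0, p1) = (q1, p1)"
      "boundary_flow H \<phi> h 0 (q1, p2) = (q1, p1)" "boundary_flow H \<phi> h h (q1, p2) = (q2, p2)"
    using *[of 0] *[of "Suc 0"] by simp_all
  have traj: "trajectory H \<phi> {0..h} (\<lambda>t. boundary_flow H \<phi> h t z)" for z
    using boundary_solution_flow[OF assms(3)] by (simp add: boundary_solution_def)
  \<comment> \<open>The second solution is delayed by \<open>h\<close>. At time \<open>h\<close> the
    pieces meet in \<open>(q1, p1)\<close>, the end of the first and the start of the second by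
    \<open>ends\<close>.\<close>
  let ?x = "\<lambda>t. if t \<in> {0..h} then boundary_flow H \<phi> h t (q0, p1) else boundary_flow H \<phi> h (t + - h) (q1, p2)"
  have "trajectory H \<phi> {0..2 * h} ?x"
    by (rule trajectory_concat[OF traj trajectory_shift[OF traj]]) (use assms(2) ends in auto)
  moreover have "?x 0 = (q0, p0)" "?x h = (q1, p1)" "?x (2 * h) = (q2, p2)"
    using assms(2) ends by auto
  ultimately show "\<exists>q p. trajectory H \<phi> {0..2 * h} (\<lambda>t. (q t, p t)) \<and>
      (q 0, p 0) = (q0, p0) \<and> (q h, p h) = (q1, p1) \<and> (q (2 * h), p (2 * h)) = (q2, p2)"
    by (intro exI[of _ "\<lambda>t. fst (?x t)"] exI[of _ "\<lambda>t. snd (?x t)"]) simp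
qed

end
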